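(* Let $m\ge2$ be an integer. For every $k\in\{1,2,\ldots,m-1\}$, $$ \sum_{r=1}^{m-1}\Psi\!\left(\frac rm\right)\cos\frac{2\pi rk}{m}=m\ln\!\left(2\sin\frac{k\pi}{m}\right)+\gamma,\qquad \sum_{r=1}^{m-1}\Psi\!\left(\frac rm\right)\sin\frac{2\pi rk}{m}=\frac\pi2(2k-m), $$ and $$ \sum_{r=1}^{m-1}\Psi^2\!\left(\frac rm\right)=(m-1)\gamma^2+m(2\gamma+\ln4m)\ln m-m(m-1)\ln^22+\frac{\pi^2(m^2-3m+2)}{12}+m\sum_{l=1}^{m-1}\ln^2\sin\frac{\pi l}{m}. $$
   Context: $\Psi=\Gamma'/\Gamma$ is the Digamma function and $\gamma$ is Euler's constant. $\Psi^2(x)=(\Psi(x))^2$, $\ln4m=\ln(4m)$, $\ln^22=(\ln2)^2$, $\ln^2\sin x=(\ln\sin x)^2$. *)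

theory Defs
  imports "HOL-Analysis.Analysis"
begin

text \<open>
  \<open>\<Psi>\<close> is the library's \<open>Digamma\<close> (an abbreviation for \<open>Polygamma 0\<close>, introduced there by its
  series); the following confirms \<open>\<Psi> = \<Gamma>' / \<Gamma>\<close> on the positive reals.
\<close>

lemma Digamma_eq_deriv_Gamma_quotient:
  fixes x :: real
  assumes "x > 0"
  shows "Digamma x = deriv Gamma x / Gamma x"
proof -
  have x: "x \<notin> \<int>\<^sub>\<le>\<^sub>0"
    using assms by (auto elim!: nonpos_Ints_cases)
  have "(Gamma has_field_derivative Gamma x * Digamma x) (at x)"
    using x by (rule has_field_derivative_Gamma)
  then have "deriv Gamma x = Gamma x * Digamma x"
    by (rule DERIV_imp_deriv)
  moreover have "Gamma x \<noteq> 0"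
    using x by (simp add: Gamma_eq_zero_iff)
  ultimately show ?thesis by simp
qed

end

(* For w = exp(2 pi i k/m) with 0 < k < m, the terms ln N in the limit formula for the Digamma
   function cancel, and regrouping its partial sums by j = n m + r gives
   sum_{r=1..m} Psi(r/m) w^r = - m sum_{j>=1} w^j/j = m Ln (1 - w),
   by the logarithm series on the boundary of the unit disc. The real and imaginary parts are the
   first two identities (the term r = m contributes Psi(1) = - gamma). Parseval's identity for this
   discrete Fourier transform gives the third; the linear term sum_l ln sin (pi l/m) that arises is
   evaluated by Fourier inversion at r = m. *)
theory Submission
  imports Defs
begin

section \<open>The logarithm series on the closed unit disc\<close>

lemma log_series_unit_disc:
  fixes z :: complex
  assumes "norm z \<le> 1" "z \<noteq> 1"
  shows "(\<lambda>n. z ^ Suc n / of_nat (Suc n)) sums (- Ln (1 - z))"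
proof -
  have Re_z: "Re z < 1"
  proof (rule ccontr)
    assume "\<not> Re z < 1"
    moreover have "Re z \<le> norm z" by (rule complex_Re_le_cmod)
    ultimately have "Re z = 1" "norm z = 1" using assms(1) by linarith+
    hence "Im z = 0" by (simp add: cmod_def)
    with \<open>Re z = 1\<close> assms(2) show False by (simp add: complex_eq_iff)
  qed
  \<comment> \<open>Lower bound for the real part of \<open>1 - t * z\<close> along the segment from
    0 to \<open>z\<close>: the minimum is at \<open>t = 1\<close> if \<open>Re z >= 0\<close> and at
    \<open>t = 0\<close> otherwise. It keeps the segment off the branch cut of \<open>Ln\<close> and
    bounds the denominator of \<open>f'\<close>.\<close>
  define d where "d = min 1 (1 - Re z)"
  have d: "d > 0" using Re_z by (simp add: d_def)
  have Re_ge: "Re (1 - of_real t * z) \<ge> d" if "t \<in> {0..1}" for t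
  proof (cases "Re z \<ge> 0")
    case True
    hence "t * Re z \<le> 1 * Re z" using that by (intro mult_right_mono) auto
    thus ?thesis by (simp add: d_def)
  next
    case False
    hence "t * Re z \<le> 0" using that by (simp add: mult_nonneg_nonpos)
    thus ?thesis by (simp add: d_def)
  qed
  define f where
    "f = (\<lambda>n t. (\<Sum>k<n. (of_real t * z) ^ Suc k / of_nat (Suc k)) + Ln (1 - of_real t * z))"
  \<comment> \<open>The derivative of \<open>f n\<close> collapses to \<open>f' n\<close>, which is at most \<open>t ^ n / d\<close> in norm, so
    integrating over \<open>[0, 1]\<close> replaces an appeal to Abel's limit theorem.\<close>
  define f' where "f' = (\<lambda>n t. - z * (of_real t * z) ^ n / (1 - of_real t * z))"
  have deriv: "(f n has_vector_derivative f' n t) (at t)" if t: "t \<in> {0..1}" for n t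
  proof -
    have Re_pos: "Re (1 - of_real t * z) > 0" using Re_ge[OF t] d by linarith
    hence nz: "1 - of_real t * z \<notin> \<real>\<^sub>\<le>\<^sub>0"
      by (auto simp: complex_nonpos_Reals_iff)
    have nz': "of_real t * z \<noteq> 1"
    proof
      assume "of_real t * z = 1"
      with Re_pos show False by (simp only: diff_self zero_complex.sel)
    qed
    have "((\<lambda>w. (\<Sum>k<n. (w * z) ^ Suc k / of_nat (Suc k)) + Ln (1 - w * z))
            has_field_derivative
            (\<Sum>k<n. z * (of_real t * z) ^ k) - z / (1 - of_real t * z)) (at (of_real t))"
    proof -
      have "((\<lambda>w. (w * z) ^ Suc k / of_nat (Suc k)) has_field_derivative z * (of_real t * z) ^ k)
              (at (of_real t))" for k
        by (rule DERIV_cong[OF DERIV_cdivide[OF DERIV_power[OF DERIV_cmult_right[OF DERIV_ident]]]])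
           (simp del: of_nat_Suc)
      moreover have "((\<lambda>w. Ln (1 - w * z)) has_field_derivative - (z / (1 - of_real t * z)))
              (at (of_real t))"
        using nz by (auto intro!: derivative_eq_intros simp: field_simps)
      ultimately show ?thesis
        unfolding diff_conv_add_uminus by (intro DERIV_add DERIV_sum)
    qed
    also have "(\<Sum>k<n. z * (of_real t * z) ^ k) - z / (1 - of_real t * z) = f' n t"
      using nz' unfolding f'_def sum_distrib_left [symmetric]
      by (subst sum_gp_strict) (auto simp: divide_simps, simp add: algebra_simps)
    finally have "((\<lambda>x. (\<Sum>k<n. (of_real x * z) ^ Suc k / of_nat (Suc k)) + Ln (1 - of_real x * z))
            has_vector_derivative f' n t) (at t)"
      by (rule has_vector_derivative_real_field)
    thus ?thesis by (simp add: f_def)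
  qed
  have bound: "norm (f n 1) \<le> 1 / d * inverse (real (Suc n))" for n
  proof -
    \<comment> \<open>The right-hand side is the increment over [0, 1] of an antiderivative of the
      bound \<open>t ^ n / d\<close>. Moreover \<open>f n 0 = 0\<close>, since every summand
      vanishes there and \<open>Ln 1 = 0\<close>.\<close>
    have "norm (f n 1 - f n 0) \<le> 1 ^ Suc n / (d * real (Suc n)) - 0 ^ Suc n / (d * real (Suc n))"
    proof (rule differentiable_bound_general)
      show "continuous_on {0..1} (f n)"
        using deriv by (intro continuous_at_imp_continuous_on ballI)
          (auto dest: has_vector_derivative_continuous)
      show "continuous_on {0..1} (\<lambda>x. x ^ Suc n / (d * real (Suc n)))"
        using d by (intro continuous_intros) auto
      fix t :: real assume t: "0 < t" "t < 1"
      show "(f n has_vector_derivative f' n t) (at t)" using t by (intro deriv) auto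
      show "((\<lambda>x. x ^ Suc n / (d * real (Suc n))) has_vector_derivative t ^ n / d) (at t)"
        unfolding has_real_derivative_iff_has_vector_derivative [symmetric]
        using d by (auto intro!: derivative_eq_intros simp: field_simps simp del: power_Suc of_nat_Suc)
      have "norm (1 - of_real t * z) \<ge> d"
        using Re_ge[of t] t complex_Re_le_cmod[of "1 - of_real t * z"] by auto
      moreover have "norm z * (t * norm z) ^ n \<le> 1 * (t * 1) ^ n"
        using assms(1) t by (intro mult_mono power_mono) auto
      ultimately show "norm (f' n t) \<le> t ^ n / d"
        using t d unfolding f'_def
        by (auto simp: norm_mult norm_divide norm_power intro!: frac_le)
    qed auto
    thus ?thesis by (simp add: f_def field_simps)
  qed
  have "(\<lambda>n. f n 1) \<longlonglongrightarrow> 0"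
  proof (rule Lim_null_comparison)
    show "\<forall>\<^sub>F n in sequentially. norm (f n 1) \<le> 1 / d * inverse (real (Suc n))"
      using bound by simp
    show "(\<lambda>n. 1 / d * inverse (real (Suc n))) \<longlonglongrightarrow> 0"
      by (intro tendsto_mult_right_zero LIMSEQ_inverse_real_of_nat)
  qed
  from tendsto_diff[OF this tendsto_const[of "Ln (1 - z)"]]
  show ?thesis by (simp add: f_def sums_def)
qed

text \<open>Half-angle formulas give 1 - e^(it) = 2 sin(t/2) e^(i(t - pi)/2). For t in (0, 2 pi) the
  modulus is positive and the angle lies in (-pi/2, pi/2), so this is the principal branch.\<close>

lemma Ln_one_minus_cis:
  assumes "0 < t" "t < 2 * pi"
  shows "Ln (1 - cis t) = Complex (ln (2 * sin (t / 2))) ((t - pi) / 2)"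
proof (rule Ln_unique)
  have s: "sin (t / 2) > 0" using assms by (intro sin_gt_zero) auto
  have c: "cos t = 1 - 2 * sin (t / 2) * sin (t / 2)" "sin t = 2 * sin (t / 2) * cos (t / 2)"
    using cos_double_sin[of "t / 2"] sin_double[of "t / 2"] by (simp_all add: power2_eq_square)
  have "cos ((t - pi) / 2) = sin (t / 2)" "sin ((t - pi) / 2) = - cos (t / 2)"
    by (simp_all add: diff_divide_distrib cos_diff sin_diff)
  thus "exp (Complex (ln (2 * sin (t / 2))) ((t - pi) / 2)) = 1 - cis t"
    using s by (simp add: exp_eq_polar complex_eq_iff c)
qed (use assms in auto)

section \<open>Finite Fourier analysis modulo \<open>m\<close>\<close>

text \<open>Orthogonality of the characters modulo \<open>m\<close>, from the geometric sum of a
  ratio \<open>z\<close> with \<open>z ^ m = 1\<close>. The frequency \<open>d\<close> is an integer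
  because it is later a difference of two indices.\<close>

lemma sum_cis_root_of_unity:
  fixes d :: int
  assumes "m > 0"
  shows "(\<Sum>k<m. cis (2 * pi * real k * of_int d / real m)) = (if int m dvd d then of_nat m else 0)"
proof -
  define z where "z = cis (2 * pi * of_int d / real m)"
  have pow: "cis (2 * pi * real k * of_int d / real m) = z ^ k" for k
    unfolding z_def Complex.DeMoivre by (simp add: mult_ac)
  have "2 * pi * real m * of_int d / real m = 2 * pi * of_int d" using assms by simp
  hence zm: "z ^ m = 1"
    unfolding pow [symmetric] by (simp only: cis_multiple_2pi Ints_of_int)
  have "z = 1 \<longleftrightarrow> int m dvd d"
  proof
    assume "z = 1"
    hence "cos (2 * pi * of_int d / real m) = 1" by (simp add: z_def complex_eq_iff)
    then obtain n :: int where "2 * pi * of_int d / real m = n * 2 * pi"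
      by (auto simp: cos_one_2pi_int)
    hence "real_of_int d = real_of_int (int m * n)"
      using assms by (simp add: field_simps)
    thus "int m dvd d" by (simp only: of_int_eq_iff) auto
  next
    assume "int m dvd d"
    then obtain n where "d = int m * n" by blast
    hence "2 * pi * of_int d / real m = 2 * pi * of_int n" using assms by simp
    thus "z = 1" unfolding z_def by (simp only: cis_multiple_2pi Ints_of_int)
  qed
  thus ?thesis
    unfolding pow using zm by (cases "z = 1") (auto simp: sum_gp_strict)
qed

lemma int_dvd_diff_iff_eq:
  assumes "r \<in> {1..m}" "s \<in> {1..m}"
  shows "int m dvd int r - int s \<longleftrightarrow> r = s"
proof
  assume "int m dvd int r - int s"
  moreover have "\<bar>int r - int s\<bar> < int m" using assms by auto
  ultimately have "int r - int s = 0" using dvd_imp_le_int[of "int r - int s" "int m"] by linarith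
  thus "r = s" by simp
qed auto

text \<open>The terms are indexed by \<open>r = 1, \<dots>, m\<close> rather than from 0, as \<open>Digamma\<close> has a pole at 0.\<close>

definition dft :: "nat \<Rightarrow> (nat \<Rightarrow> complex) \<Rightarrow> nat \<Rightarrow> complex" where
  "dft m f k = (\<Sum>r=1..m. f r * cis (2 * pi * real r * real k / real m))"

text \<open>After exchanging the sums, orthogonality kills every frequency \<open>r - s\<close> not
  divisible by \<open>m\<close>; within {1..m} only \<open>r = s\<close> survives.\<close>

lemma dft_inversion:
  assumes "s \<in> {1..m}"
  shows "(\<Sum>k<m. dft m f k * cis (- (2 * pi * real s * real k / real m))) = of_nat m * f s"
proof -
  have "(\<Sum>k<m. dft m f k * cis (- (2 * pi * real s * real k / real m))) =
      (\<Sum>k<m. \<Sum>r=1..m. f r * cis (2 * pi * real k * of_int (int r - int s) / real m))"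
    unfolding dft_def sum_distrib_right
    by (intro sum.cong refl)
       (simp add: mult.assoc cis_mult, simp add: algebra_simps diff_divide_distrib)
  also have "\<dots> = (\<Sum>r=1..m. f r * (\<Sum>k<m. cis (2 * pi * real k * of_int (int r - int s) / real m)))"
    by (subst sum.swap) (simp add: sum_distrib_left)
  also have "\<dots> = (\<Sum>r=1..m. if r = s then of_nat m * f s else 0)"
    using assms by (intro sum.cong refl, subst sum_cis_root_of_unity)
      (auto simp: int_dvd_diff_iff_eq)
  finally show ?thesis using assms by simp
qed

text \<open>Writing the squared norm as the transform times its conjugate and expanding only the
  conjugate leaves, for each \<open>s\<close>, exactly the sum evaluated by inversion.\<close>

lemma dft_Parseval:
  "(\<Sum>k<m. (norm (dft m f k))\<^sup>2) = real m * (\<Sum>s=1..m. (norm (f s))\<^sup>2)"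
proof -
  have "complex_of_real (\<Sum>k<m. (norm (dft m f k))\<^sup>2) =
      (\<Sum>k<m. \<Sum>s=1..m. cnj (f s) * (dft m f k * cis (- (2 * pi * real s * real k / real m))))"
    unfolding of_real_sum
  proof (rule sum.cong [OF refl])
    fix k
    have "cnj (dft m f k) = (\<Sum>s=1..m. cnj (f s) * cis (- (2 * pi * real s * real k / real m)))"
      by (simp add: dft_def cis_cnj)
    thus "complex_of_real ((norm (dft m f k))\<^sup>2) =
        (\<Sum>s=1..m. cnj (f s) * (dft m f k * cis (- (2 * pi * real s * real k / real m))))"
      unfolding complex_norm_square by (simp add: sum_distrib_left mult_ac)
  qed
  also have "\<dots> = (\<Sum>s=1..m. cnj (f s) * (of_nat m * f s))"
    by (subst sum.swap) (simp add: sum_distrib_left [symmetric] dft_inversion)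
  also have "\<dots> = of_real (real m * (\<Sum>s=1..m. (norm (f s))\<^sup>2))"
    unfolding of_real_mult of_real_sum complex_norm_square
    by (simp add: sum_distrib_left mult_ac)
  finally show ?thesis by (simp only: of_real_eq_iff)
qed

section \<open>The Fourier transform of the Digamma values\<close>

text \<open>Since 1/(r/m + n) = m/(r + n m), the truncated Digamma limits for all \<open>r\<close>
  together run once through the integers 1, ..., \<open>N * m\<close>, and periodicity turns the
  weight \<open>g r\<close> into \<open>g (r + n * m)\<close>. An arbitrary periodic
  \<open>g\<close> covers both the zero frequency, where the \<open>ln N\<close> terms survive, and
  the others, where they cancel.\<close>

lemma Digamma_periodic_sum_LIMSEQ:
  fixes g :: "nat \<Rightarrow> complex"
  assumes "m > 0" and periodic: "\<And>j. g (j + m) = g j"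
  shows "(\<lambda>N. of_real (ln (real N)) * (\<Sum>r=1..m. g r)
              - of_nat m * (\<Sum>j<N * m. g (Suc j) / of_nat (Suc j)))
         \<longlonglongrightarrow> (\<Sum>r=1..m. of_real (Digamma (real r / real m)) * g r)"
proof -
  have per: "g (j + n * m) = g j" for j n
  proof (induction n)
    case (Suc n)
    have "g (j + Suc n * m) = g ((j + n * m) + m)" by (simp add: add_ac)
    also have "\<dots> = g (j + n * m)" by (rule periodic)
    finally show ?case using Suc by simp
  qed simp
  have "(\<lambda>N. \<Sum>r=1..m. of_real (ln (real N) - (\<Sum>n<N. inverse (real r / real m + real n))) * g r)
         \<longlonglongrightarrow> (\<Sum>r=1..m. of_real (Digamma (real r / real m)) * g r)"
  proof (intro tendsto_sum tendsto_mult tendsto_of_real tendsto_const)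
    fix r assume "r \<in> {1..m}"
    hence "real r / real m \<noteq> 0" by auto
    from Digamma_LIMSEQ[OF this]
    show "(\<lambda>N. ln (real N) - (\<Sum>n<N. inverse (real r / real m + real n))) \<longlonglongrightarrow> Digamma (real r / real m)"
      by simp
  qed
  also have "(\<lambda>N. \<Sum>r=1..m. of_real (ln (real N) - (\<Sum>n<N. inverse (real r / real m + real n))) * g r)
     = (\<lambda>N. of_real (ln (real N)) * (\<Sum>r=1..m. g r)
              - of_nat m * (\<Sum>j<N * m. g (Suc j) / of_nat (Suc j)))"
  proof
    fix N
    have "(\<Sum>r=1..m. of_real (\<Sum>n<N. inverse (real r / real m + real n)) * g r)
        = (\<Sum>n<N. \<Sum>r=1..m. of_real (inverse (real r / real m + real n)) * g r)"
      by (subst sum.swap) (simp add: sum_distrib_right)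
    also have "\<dots> = (\<Sum>n<N. \<Sum>j=n * m..<n * m + m. of_nat m * (g (Suc j) / of_nat (Suc j)))"
    proof (rule sum.cong [OF refl])
      fix n
      have "(\<Sum>r=1..m. of_real (inverse (real r / real m + real n)) * g r)
          = (\<Sum>r=1..m. of_nat m * (g (r + n * m) / of_nat (r + n * m)))"
      proof (rule sum.cong [OF refl])
        fix r assume "r \<in> {1..m}"
        have "inverse (real r / real m + real n) = real m / real (r + n * m)"
          using assms(1) by (simp add: field_simps)
        thus "of_real (inverse (real r / real m + real n)) * g r
            = of_nat m * (g (r + n * m) / of_nat (r + n * m))"
          by (simp add: per)
      qed
      also have "\<dots> = (\<Sum>j=n * m..<n * m + m. of_nat m * (g (Suc j) / of_nat (Suc j)))"
        \<comment> \<open>The shift by 1 arises because \<open>r\<close> starts at 1 while the block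
          of \<open>j\<close> starts at \<open>n * m\<close>; the integer in the denominator is
          \<open>Suc j = r + n * m\<close>.\<close>
        by (rule sum.reindex_bij_witness[of _ "\<lambda>j. Suc j - n * m" "\<lambda>r. r + n * m - 1"]) auto
      finally show "(\<Sum>r=1..m. of_real (inverse (real r / real m + real n)) * g r)
          = (\<Sum>j=n * m..<n * m + m. of_nat m * (g (Suc j) / of_nat (Suc j)))" .
    qed
    also have "\<dots> = of_nat m * (\<Sum>j<N * m. g (Suc j) / of_nat (Suc j))"
      by (simp only: sum.nat_group sum_distrib_left)
    finally show "(\<Sum>r=1..m. of_real (ln (real N) - (\<Sum>n<N. inverse (real r / real m + real n))) * g r)
       = of_real (ln (real N)) * (\<Sum>r=1..m. g r)
              - of_nat m * (\<Sum>j<N * m. g (Suc j) / of_nat (Suc j))"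
      by (simp only: of_real_diff left_diff_distrib sum_subtractf sum_distrib_left)
  qed
  finally show ?thesis .
qed

text \<open>An instance of Gauss's multiplication formula. With constant weight 1 the limit
  expression is m ln N - m H(N m) = -m (H(N m) - ln (N m)) - m ln m, where H is the harmonic number,
  and the bracket tends to Euler's constant.\<close>

lemma Digamma_multiplication:
  assumes "m > 0"
  shows "(\<Sum>r=1..m. Digamma (real r / real m)) = - real m * (euler_mascheroni + ln (real m))"
proof -
  have harm: "(\<Sum>j<n. 1 / of_nat (Suc j)) = complex_of_real (harm n)" for n
    by (simp add: harm_def sum.atLeast1_atMost_eq inverse_eq_divide)
  have "(\<lambda>N. of_real (- real m * (harm (N * m) - ln (real (N * m))) - real m * ln (real m)))
      \<longlonglongrightarrow> complex_of_real (\<Sum>r=1..m. Digamma (real r / real m))"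
  proof (rule Lim_transform_eventually)
    show "(\<lambda>N. of_real (ln (real N)) * (\<Sum>r=1..m. 1)
              - of_nat m * (\<Sum>j<N * m. 1 / of_nat (Suc j)))
         \<longlonglongrightarrow> complex_of_real (\<Sum>r=1..m. Digamma (real r / real m))"
      using Digamma_periodic_sum_LIMSEQ[OF assms, of "\<lambda>_. 1"] by simp
    show "\<forall>\<^sub>F N in sequentially. of_real (ln (real N)) * (\<Sum>r=1..m. 1)
              - of_nat m * (\<Sum>j<N * m. 1 / of_nat (Suc j)) =
          complex_of_real (- real m * (harm (N * m) - ln (real (N * m))) - real m * ln (real m))"
      using eventually_gt_at_top[of 0]
    proof eventually_elim
      case (elim N)
      thus ?case using assms unfolding harm by (simp add: ln_mult algebra_simps)
    qed
  qed
  moreover have "(\<lambda>N. complex_of_real (- real m * (harm (N * m) - ln (real (N * m))) - real m * ln (real m)))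
      \<longlonglongrightarrow> of_real (- real m * euler_mascheroni - real m * ln (real m))"
    using assms
    by (intro tendsto_intros filterlim_compose[OF euler_mascheroni_LIMSEQ] mult_nat_right_at_top)
  ultimately have "complex_of_real (\<Sum>r=1..m. Digamma (real r / real m))
      = of_real (- real m * euler_mascheroni - real m * ln (real m))"
    by (rule LIMSEQ_unique)
  thus ?thesis by (simp only: of_real_eq_iff) (simp add: algebra_simps)
qed

lemma dft_Digamma_0:
  assumes "m > 0"
  shows "dft m (\<lambda>r. of_real (Digamma (real r / real m))) 0
           = of_real (- real m * (euler_mascheroni + ln (real m)))"
  unfolding Digamma_multiplication [OF assms, symmetric] by (simp add: dft_def)

lemma dft_Digamma:
  assumes "k \<in> {1..<m}"
  shows "dft m (\<lambda>r. of_real (Digamma (real r / real m))) k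
           = Complex (real m * ln (2 * sin (real k * pi / real m))) (pi / 2 * (2 * real k - real m))"
proof -
  define z where "z = cis (2 * pi * real k / real m)"
  have pow: "cis (2 * pi * real r * real k / real m) = z ^ r" for r
    unfolding z_def Complex.DeMoivre by (simp add: mult_ac)
  have "2 * pi * real m * real k / real m = 2 * pi * real k" using assms by simp
  hence zm: "z ^ m = 1"
    unfolding pow [symmetric] by (simp only: cis_multiple_2pi Ints_of_nat)
  have Ln: "Ln (1 - z) = Complex (ln (2 * sin (real k * pi / real m))) ((2 * pi * real k / real m - pi) / 2)"
    using assms unfolding z_def by (subst Ln_one_minus_cis) (auto simp: field_simps)
  have "\<not> int m dvd int k" using assms by (auto dest: zdvd_imp_le)
  \<comment> \<open>Orthogonality makes the power sum of \<open>z\<close> vanish, whereas for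
    \<open>z = 1\<close> it would equal \<open>m\<close>.\<close>
  have z1: "z \<noteq> 1"
  proof
    assume "z = 1"
    have "(\<Sum>j<m. z ^ j) = 0"
      using sum_cis_root_of_unity[of m "int k"] \<open>\<not> int m dvd int k\<close> assms
      by (simp add: pow)
    thus False using \<open>z = 1\<close> assms by simp
  qed
  have sum0: "(\<Sum>r=1..m. z ^ r) = 0"
    using z1 zm by (simp add: sum_gp)
  have "(\<lambda>N. of_real (ln (real N)) * (\<Sum>r=1..m. z ^ r)
              - of_nat m * (\<Sum>j<N * m. z ^ Suc j / of_nat (Suc j)))
         \<longlonglongrightarrow> (\<Sum>r=1..m. of_real (Digamma (real r / real m)) * z ^ r)"
    using assms zm by (intro Digamma_periodic_sum_LIMSEQ) (auto simp: power_add)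
  \<comment> \<open>With the logarithmic term gone, what remains is the subsequence of partial sums
    of length \<open>N * m\<close> of the series for \<open>- Ln (1 - z)\<close>.\<close>
  moreover have "(\<lambda>N. of_real (ln (real N)) * (\<Sum>r=1..m. z ^ r)
              - of_nat m * (\<Sum>j<N * m. z ^ Suc j / of_nat (Suc j)))
         \<longlonglongrightarrow> 0 - of_nat m * (- Ln (1 - z))"
    unfolding sum0 mult_zero_right using assms z1
    by (intro tendsto_intros filterlim_compose[OF log_series_unit_disc[unfolded sums_def]]
          mult_nat_right_at_top) (auto simp: z_def)
  ultimately have "(\<Sum>r=1..m. of_real (Digamma (real r / real m)) * z ^ r) = of_nat m * Ln (1 - z)"
    using LIMSEQ_unique by fastforce
  thus ?thesis
    using assms unfolding dft_def pow Ln by (simp add: complex_eq_iff field_simps)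
qed

section \<open>Evaluation of the finite sums\<close>

lemma sum_atLeast1_atMost_split_last:
  fixes f :: "nat \<Rightarrow> 'a::comm_monoid_add"
  assumes "m > 0"
  shows "(\<Sum>r=1..m. f r) = (\<Sum>r=1..m-1. f r) + f m"
  using assms by (cases m) simp_all

lemma sum_lessThan_split_first:
  fixes f :: "nat \<Rightarrow> 'a::comm_monoid_add"
  assumes "m > 0"
  shows "(\<Sum>k<m. f k) = f 0 + (\<Sum>k=1..m-1. f k)"
  using assms by (cases m) (simp_all add: sum.lessThan_Suc_shift sum.atLeast1_atMost_eq del: sum.lessThan_Suc)

text \<open>The logarithm of the classical product of sin(pi k/m) over 0 < k < m, which is m /
  2^(m-1). It comes from comparing real parts in Fourier inversion at \<open>m\<close>, where the
  Digamma value is minus Euler's constant; that constant cancels against the zero frequency.\<close>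

lemma sum_ln_sin:
  assumes "m > 0"
  shows "(\<Sum>k=1..m-1. ln (sin (pi * real k / real m))) = ln (real m) - (real m - 1) * ln 2"
proof -
  define f where "f = (\<lambda>r. complex_of_real (Digamma (real r / real m)))"
  \<comment> \<open>At \<open>s = m\<close> all twisting factors equal 1, so the plain sum of the
    transform is an inversion sum.\<close>
  have "(\<Sum>k<m. dft m f k) = (\<Sum>k<m. dft m f k * cis (- (2 * pi * real m * real k / real m)))"
  proof (rule sum.cong [OF refl])
    fix k
    have "- (2 * pi * real m * real k / real m) = 2 * pi * (- real k)" using assms by simp
    hence "cis (- (2 * pi * real m * real k / real m)) = 1"
      by (simp only: cis_multiple_2pi Ints_minus Ints_of_nat)
    thus "dft m f k = dft m f k * cis (- (2 * pi * real m * real k / real m))" by simp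
  qed
  also have "\<dots> = of_nat m * f m"
    using assms by (intro dft_inversion) auto
  also have "\<dots> = of_real (- real m * euler_mascheroni)"
    using assms by (simp add: f_def)
  finally have "(\<Sum>k<m. Re (dft m f k)) = - real m * euler_mascheroni"
    by (simp only: Re_sum [symmetric] Re_complex_of_real)
  also have "(\<Sum>k<m. Re (dft m f k)) = - real m * (euler_mascheroni + ln (real m))
      + (\<Sum>k=1..m-1. real m * (ln 2 + ln (sin (pi * real k / real m))))"
  proof -
    have "Re (dft m f k) = real m * (ln 2 + ln (sin (pi * real k / real m)))" if "k \<in> {1..m-1}" for k
    proof -
      have "sin (pi * real k / real m) > 0"
        using that by (intro sin_gt_zero) (auto simp: field_simps)
      thus ?thesis using that unfolding f_def
        by (subst dft_Digamma) (auto simp: ln_mult mult.commute)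
    qed
    moreover have "Re (dft m f 0) = - real m * (euler_mascheroni + ln (real m))"
      unfolding f_def dft_Digamma_0[OF assms] by (rule Re_complex_of_real)
    ultimately show ?thesis
      by (simp add: sum_lessThan_split_first[OF assms])
  qed
  finally have "real m * (\<Sum>k=1..m-1. ln 2 + ln (sin (pi * real k / real m))) = real m * ln (real m)"
    by (simp add: sum_distrib_left algebra_simps)
  thus ?thesis using assms by (simp add: sum.distrib of_nat_diff)
qed

text \<open>The centre \<open>x\<close> is independent of \<open>m\<close> so that it stays fixed in
  the induction; the application takes \<open>x = m\<close>.\<close>

lemma sum_squares_centred:
  assumes "m > 0"
  shows "(\<Sum>k=1..m-1. (2 * real k - x)\<^sup>2)
    = 2 * real m * (real m - 1) * (2 * real m - 1) / 3 - 2 * x * real m * (real m - 1) + (real m - 1) * x\<^sup>2"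
  using assms
proof (induction m rule: nat_induct_non_zero)
  case (Suc n)
  thus ?case
    unfolding diff_Suc_1 sum_atLeast1_atMost_split_last[OF Suc.hyps]
    by (simp add: field_simps power2_eq_square)
qed simp

lemma sum_Digamma_squared:
  assumes m: "m > 0"
  shows "(\<Sum>r=1..m-1. (Digamma (real r / real m))\<^sup>2)
           = (real m - 1) * euler_mascheroni\<^sup>2
             + real m * (2 * euler_mascheroni + ln (4 * real m)) * ln (real m)
             - real m * (real m - 1) * (ln 2)\<^sup>2
             + pi\<^sup>2 * ((real m)\<^sup>2 - 3 * real m + 2) / 12
             + real m * (\<Sum>l=1..m-1. (ln (sin (pi * real l / real m)))\<^sup>2)"
proof -
  define f where "f = (\<lambda>r. complex_of_real (Digamma (real r / real m)))"
  define S where "S = (\<Sum>l=1..m-1. (ln (sin (pi * real l / real m)))\<^sup>2)"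
  \<comment> \<open>The square of the real part m (ln 2 + ln sin) is expanded so that its linear
    term can be summed by \<open>sum_ln_sin\<close>; the last summand is the squared imaginary
    part.\<close>
  have norm_dft: "(norm (dft m f k))\<^sup>2
      = (real m)\<^sup>2 * (ln 2)\<^sup>2 + 2 * (real m)\<^sup>2 * ln 2 * ln (sin (pi * real k / real m))
        + (real m)\<^sup>2 * (ln (sin (pi * real k / real m)))\<^sup>2 + pi\<^sup>2 / 4 * (2 * real k - real m)\<^sup>2"
    if "k \<in> {1..m-1}" for k
  proof -
    have "sin (pi * real k / real m) > 0"
      using that by (intro sin_gt_zero) (auto simp: field_simps)
    hence "ln (2 * sin (real k * pi / real m)) = ln 2 + ln (sin (pi * real k / real m))"
      by (simp add: ln_mult mult.commute)
    thus ?thesis using that unfolding f_def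
      by (subst dft_Digamma) (auto simp: cmod_power2, simp add: power2_eq_square field_simps)
  qed
  \<comment> \<open>Parseval includes the index \<open>r = m\<close>, whose Digamma value
    contributes the extra square of Euler's constant. Subtracting it later turns the factor
    \<open>m\<close> coming from the zero frequency into \<open>m - 1\<close>.\<close>
  have "real m * ((\<Sum>r=1..m-1. (Digamma (real r / real m))\<^sup>2) + euler_mascheroni\<^sup>2)
      = (\<Sum>k<m. (norm (dft m f k))\<^sup>2)"
    using m unfolding dft_Parseval sum_atLeast1_atMost_split_last[OF m]
    by (simp add: f_def del: of_real_euler_mascheroni)
  also have "\<dots> = (real m)\<^sup>2 * (euler_mascheroni + ln (real m))\<^sup>2
      + (\<Sum>k=1..m-1. (norm (dft m f k))\<^sup>2)"
    unfolding sum_lessThan_split_first[OF m] f_def dft_Digamma_0[OF m] norm_of_real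
    by (simp add: power_mult_distrib)
  also have "(\<Sum>k=1..m-1. (norm (dft m f k))\<^sup>2)
      = (real m - 1) * (real m)\<^sup>2 * (ln 2)\<^sup>2
        + 2 * (real m)\<^sup>2 * ln 2 * (ln (real m) - (real m - 1) * ln 2)
        + (real m)\<^sup>2 * S + pi\<^sup>2 / 4 * (real m * (real m - 1) * (real m - 2) / 3)"
  proof -
    have sq: "(\<Sum>k=1..m-1. (2 * real k - real m)\<^sup>2) = real m * (real m - 1) * (real m - 2) / 3"
      unfolding sum_squares_centred[OF m] by (simp add: field_simps power2_eq_square)
    have "(\<Sum>k=1..m-1. (norm (dft m f k))\<^sup>2)
      = (\<Sum>k=1..m-1. (real m)\<^sup>2 * (ln 2)\<^sup>2)
        + 2 * (real m)\<^sup>2 * ln 2 * (\<Sum>k=1..m-1. ln (sin (pi * real k / real m)))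
        + (real m)\<^sup>2 * S + pi\<^sup>2 / 4 * (\<Sum>k=1..m-1. (2 * real k - real m)\<^sup>2)"
      unfolding S_def sum_distrib_left sum.distrib [symmetric]
      by (rule sum.cong [OF refl norm_dft])
    thus ?thesis using m unfolding sq sum_ln_sin[OF m] by (simp add: of_nat_diff)
  qed
  \<comment> \<open>\<open>2 * ln 2 + ln m\<close> joins the cross term of \<open>norm_dft\<close>
    with the squared logarithm from the zero frequency; it is \<open>ln (4 * m)\<close>.\<close>
  finally have "real m * (\<Sum>r=1..m-1. (Digamma (real r / real m))\<^sup>2)
      = real m * ((real m - 1) * euler_mascheroni\<^sup>2
             + real m * (2 * euler_mascheroni + (2 * ln 2 + ln (real m))) * ln (real m)
             - real m * (real m - 1) * (ln 2)\<^sup>2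
             + pi\<^sup>2 * ((real m)\<^sup>2 - 3 * real m + 2) / 12
             + real m * S)"
    by (simp add: field_simps power2_eq_square)
  moreover have "ln (4 * real m) = 2 * ln 2 + ln (real m)"
    using m ln_realpow[of 2 2] by (simp add: ln_mult)
  ultimately show ?thesis using m by (simp add: S_def)
qed

theorem mainTheorem8:
  fixes m :: nat
  assumes "m \<ge> 2"
  shows "(\<forall>k\<in>{1..m-1}.
            (\<Sum>r=1..m-1. Digamma (real r / real m) * cos (2 * pi * real r * real k / real m))
              = real m * ln (2 * sin (real k * pi / real m)) + euler_mascheroni
          \<and> (\<Sum>r=1..m-1. Digamma (real r / real m) * sin (2 * pi * real r * real k / real m))
              = pi / 2 * (2 * real k - real m))
       \<and> (\<Sum>r=1..m-1. (Digamma (real r / real m))\<^sup>2)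
           = (real m - 1) * euler_mascheroni\<^sup>2
             + real m * (2 * euler_mascheroni + ln (4 * real m)) * ln (real m)
             - real m * (real m - 1) * (ln 2)\<^sup>2
             + pi\<^sup>2 * ((real m)\<^sup>2 - 3 * real m + 2) / 12
             + real m * (\<Sum>l=1..m-1. (ln (sin (pi * real l / real m)))\<^sup>2)"
proof (intro conjI ballI)
  have m: "m > 0" using assms by simp
  fix k assume k: "k \<in> {1..m-1}"
  \<comment> \<open>The transform also contains \<open>r = m\<close>, where the character is 1 and
    the Digamma value is real: moving this term across adds Euler's constant to the cosine sum and
    leaves the sine sum unchanged.\<close>
  have "2 * pi * real m * real k / real m = 2 * pi * real k" using m by simp
  hence per: "cis (2 * pi * real m * real k / real m) = 1"
    by (simp only: cis_multiple_2pi Ints_of_nat)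
  have "k \<in> {1..<m}" using k by auto
  note F = dft_Digamma[OF this]
  from arg_cong[OF F, of Re]
  show "(\<Sum>r=1..m-1. Digamma (real r / real m) * cos (2 * pi * real r * real k / real m))
      = real m * ln (2 * sin (real k * pi / real m)) + euler_mascheroni"
    using m unfolding dft_def sum_atLeast1_atMost_split_last[OF m] per
    by (simp del: of_real_euler_mascheroni)
  from arg_cong[OF F, of Im]
  show "(\<Sum>r=1..m-1. Digamma (real r / real m) * sin (2 * pi * real r * real k / real m))
      = pi / 2 * (2 * real k - real m)"
    using m unfolding dft_def sum_atLeast1_atMost_split_last[OF m] per
    by (simp del: of_real_euler_mascheroni)
qed (rule sum_Digamma_squared, use assms in simp)

end
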